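(* Let $\mathcal{H}$ be a real Hilbert space, $T:\mathcal{H}\rightrightarrows\mathcal{H}$ a set-valued operator, $c:\mathcal{H}\to\mathbb{R}$ a function and $C=\{x\in\mathcal{H}: c(x)\le 0\}$, and suppose that Assumptions (A1)--(A4) of the context hold. If, in addition, $T$ is $\mu$-strongly monotone for some $\mu>0$, then every sequence $(x^k)$ generated by the algorithm FSPA described in the context converges strongly (in norm) to the unique solution $x^*\in S^*$.
   Context: $\mathcal{H}$ is a real Hilbert space with inner product $\langle\cdot,\cdot\rangle$ and norm $\|\cdot\|$. For a nonempty closed convex set $S$, $P_S$ is the metric projection onto $S$. For $T:\mathcal{H}\rightrightarrows\mathcal{H}$, $\operatorname{Gph}(T)=\{(x,u):u\in T(x)\}$ and $\operatorname{dom}T=\{x:T(x)\ne\emptyset\}$. $T$ is $\mu$-strongly monotone if $\langle u-v,x-y\rangle\ge\mu\|x-y\|^2$ for all $(x,u),(y,v)\in\operatorname{Gph}(T)$. $\partial c$ is the convex subdifferential of $c$. $[t]_+=\max\{t,0\}$. Feasible set: $C=\{x\in\mathcal{H}:c(x)\le 0\}$. Solution set: $S^*$ is the set of $x^*\in C$ for which there is $u^*\in T(x^* )$ with $\langle u^*,x-x^*\rangle\ge 0$ for all $x\in C$. Normal cone: $N_C(x)=\{n:\langle n,z-x\rangle\le 0\ \forall z\in C\}$ if $x\in C$, and $N_C(x)=\emptyset$ otherwise. Minty gap: $\Phi(x)=\sup\{\langle w,x-z\rangle: z\in C,\ w\in T(z)\}\in(-\infty,+\infty]$ and $\Phi_+(x)=\max\{\Phi(x),0\}$.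 Assumptions. (A1) $c$ is convex and continuous, $C\neq\emptyset$, and for every bounded $B\subset\mathcal{H}$ there is $M_B>0$ with $\|g\|\le M_B$ for all $x\in B$ with $c(x)>0$ and all $g\in\partial c(x)$; moreover $\partial c(x)\ne\emptyset$ whenever $c(x)>0$. (A2) A fixed point $s\in\mathcal{H}$ with $c(s)<0$ is given (Slater point). (A3) $T$ is maximal monotone, $C\subseteq\operatorname{dom}T$, $S^*\neq\emptyset$, and $T+N_C$ is maximal monotone. (A4) There are $\sigma\in(0,1]$, a sequence $\varepsilon_k\ge 0$ with $\varepsilon_k\to 0$, and an oracle which for every $x^k$ returns a trial point $\widetilde y^k\in\mathcal{H}$. One sets $\lambda_k=0$ if $c(\widetilde y^k)\le 0$ and $\lambda_k=\frac{c(\widetilde y^k)}{c(\widetilde y^k)-c(s)}$ if $c(\widetilde y^k)>0$, and $y^k=(1-\lambda_k)\widetilde y^k+\lambda_k s$; the oracle then chooses $v^k\in T(y^k)$. Whenever $(x^k)$ is bounded, the sequences $(y^k)$ and $(v^k)$ are bounded and $[\langle v^k,x^k-y^k\rangle]_+\ge\sigma\Phi_+(x^k)-\varepsilon_k$ for all $k$. Algorithm FSPA. Start from $x^0\in\mathcal{H}$. For $k=0,1,2,\dots$: 1. If $c(x^k)>0$, choose $g^k\in\partial c(x^k)$ and set $C_k=\{x: c(x^k)+\langle g^k,x-x^k\rangle\le 0\}$; otherwise set $C_k=\mathcal{H}$. 2. Obtain $\widetilde y^k$, $\lambda_k$, $y^k$, $v^k\in T(y^k)$ from the oracle as in (A4),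 and set $H_k=\{x:\langle v^k,x-y^k\rangle\le 0\}$. 3. Set $W_k=\{x:\langle x-x^k,x^0-x^k\rangle\le 0\}$. 4. Set $x^{k+1}=P_{C_k\cap H_k\cap W_k}(x^0)$. *)

theory Defs
  imports "HOL-Analysis.Analysis"
begin

definition Gph :: "('a \<Rightarrow> 'a set) \<Rightarrow> ('a \<times> 'a) set" where
  "Gph T = {(x, u). u \<in> T x}"

definition dom_op :: "('a \<Rightarrow> 'a set) \<Rightarrow> 'a set" where
  "dom_op T = {x. T x \<noteq> {}}"

definition monotone_op :: "('a::real_inner \<Rightarrow> 'a set) \<Rightarrow> bool" where
  "monotone_op T \<longleftrightarrow>
     (\<forall>(x, u) \<in> Gph T. \<forall>(y, v) \<in> Gph T. (u - v) \<bullet> (x - y) \<ge> 0)"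

definition strongly_monotone_op :: "real \<Rightarrow> ('a::real_inner \<Rightarrow> 'a set) \<Rightarrow> bool" where
  "strongly_monotone_op \<mu> T \<longleftrightarrow>
     (\<forall>(x, u) \<in> Gph T. \<forall>(y, v) \<in> Gph T. (u - v) \<bullet> (x - y) \<ge> \<mu> * (norm (x - y))\<^sup>2)"

definition maximal_monotone_op :: "('a::real_inner \<Rightarrow> 'a set) \<Rightarrow> bool" where
  "maximal_monotone_op T \<longleftrightarrow>
     monotone_op T \<and> (\<forall>S. monotone_op S \<and> Gph T \<subseteq> Gph S \<longrightarrow> Gph S = Gph T)"

definition sum_op :: "('a::plus \<Rightarrow> 'a set) \<Rightarrow> ('a \<Rightarrow> 'a set) \<Rightarrow> 'a \<Rightarrow> 'a set" where
  "sum_op S T x = {u + v | u v. u \<in> S x \<and> v \<in> T x}"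

definition normal_cone :: "'a::real_inner set \<Rightarrow> 'a \<Rightarrow> 'a set" where
  "normal_cone C x = (if x \<in> C then {n. \<forall>z\<in>C. n \<bullet> (z - x) \<le> 0} else {})"

definition subdifferential :: "('a::real_inner \<Rightarrow> real) \<Rightarrow> 'a \<Rightarrow> 'a set" where
  "subdifferential f x = {g. \<forall>y. f x + g \<bullet> (y - x) \<le> f y}"

text \<open>The library's \<^const>\<open>closest_point\<close> is restricted to spaces of class
  \<^class>\<open>heine_borel\<close>, i.e. to finite dimension; this is the same definition
  without that restriction. As a choice operator it has no specified value when no nearest
  point exists.\<close>

definition metric_proj :: "'a::metric_space set \<Rightarrow> 'a \<Rightarrow> 'a" where
  "metric_proj S a = (SOME p. p \<in> S \<and> (\<forall>z\<in>S. dist a p \<le> dist a z))"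

definition feasible_set :: "('a \<Rightarrow> real) \<Rightarrow> 'a set" where
  "feasible_set c = {x. c x \<le> 0}"

definition solution_set :: "('a::real_inner \<Rightarrow> 'a set) \<Rightarrow> 'a set \<Rightarrow> 'a set" where
  "solution_set T C = {x \<in> C. \<exists>u \<in> T x. \<forall>z\<in>C. u \<bullet> (z - x) \<ge> 0}"

definition minty_gap :: "('a::real_inner \<Rightarrow> 'a set) \<Rightarrow> 'a set \<Rightarrow> 'a \<Rightarrow> ereal" where
  "minty_gap T C x = Sup {ereal (w \<bullet> (x - z)) | z w. z \<in> C \<and> w \<in> T z}"

definition minty_gap_plus :: "('a::real_inner \<Rightarrow> 'a set) \<Rightarrow> 'a set \<Rightarrow> 'a \<Rightarrow> ereal" where
  "minty_gap_plus T C x = max (minty_gap T C x) 0"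

definition slater_weight :: "('a \<Rightarrow> real) \<Rightarrow> 'a \<Rightarrow> 'a \<Rightarrow> real" where
  "slater_weight c s p = (if c p \<le> 0 then 0 else c p / (c p - c s))"

definition slater_retract :: "('a::real_vector \<Rightarrow> real) \<Rightarrow> 'a \<Rightarrow> 'a \<Rightarrow> 'a" where
  "slater_retract c s p =
     (1 - slater_weight c s p) *\<^sub>R p + slater_weight c s p *\<^sub>R s"

definition cut_C :: "('a::real_inner \<Rightarrow> real) \<Rightarrow> 'a \<Rightarrow> 'a \<Rightarrow> 'a set" where
  "cut_C c xk gk = (if c xk > 0 then {z. c xk + gk \<bullet> (z - xk) \<le> 0} else UNIV)"

definition cut_H :: "'a::real_inner \<Rightarrow> 'a \<Rightarrow> 'a set" where
  "cut_H yk vk = {z. vk \<bullet> (z - yk) \<le> 0}"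

definition cut_W :: "'a::real_inner \<Rightarrow> 'a \<Rightarrow> 'a set" where
  "cut_W x0 xk = {z. (z - xk) \<bullet> (x0 - xk) \<le> 0}"

text \<open>The oracle is represented by the sequences \<open>yt\<close> (trial points) and \<open>v\<close> it
  returns along the run, so it may depend on the whole history. The choice \<open>g k\<close> is
  unconstrained, and unused by \<^const>\<open>cut_C\<close>, when \<open>c (x k) \<le> 0\<close>.\<close>

definition FSPA ::
  "('a::real_inner \<Rightarrow> 'a set) \<Rightarrow> ('a \<Rightarrow> real) \<Rightarrow> 'a \<Rightarrow>
   (nat \<Rightarrow> 'a) \<Rightarrow> (nat \<Rightarrow> 'a) \<Rightarrow> (nat \<Rightarrow> 'a) \<Rightarrow> (nat \<Rightarrow> 'a) \<Rightarrow> (nat \<Rightarrow> 'a) \<Rightarrow> bool" where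
  "FSPA T c s x g yt y v \<longleftrightarrow>
     (\<forall>k. (c (x k) > 0 \<longrightarrow> g k \<in> subdifferential c (x k)) \<and>
          y k = slater_retract c s (yt k) \<and>
          v k \<in> T (y k) \<and>
          x (Suc k) =
            metric_proj (cut_C c (x k) (g k) \<inter> cut_H (y k) (v k) \<inter> cut_W (x 0) (x k)) (x 0))"

definition oracle_condition ::
  "('a::real_inner \<Rightarrow> 'a set) \<Rightarrow> 'a set \<Rightarrow> real \<Rightarrow> (nat \<Rightarrow> real) \<Rightarrow>
   (nat \<Rightarrow> 'a) \<Rightarrow> (nat \<Rightarrow> 'a) \<Rightarrow> (nat \<Rightarrow> 'a) \<Rightarrow> bool" where
  "oracle_condition T C \<sigma> \<epsilon> x y v \<longleftrightarrow>
     (bounded (range x) \<longrightarrow>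
        bounded (range y) \<and> bounded (range v) \<and>
        (\<forall>k. ereal (max (v k \<bullet> (x k - y k)) 0)
              \<ge> ereal \<sigma> * minty_gap_plus T C (x k) - ereal (\<epsilon> k)))"

end

theory Submission
  imports Defs
begin

text \<open>
  Every solution lies in all three cuts, so the iterates stay within distance
  \<open>\<parallel>x* - x\<^sub>0\<parallel>\<close> of \<open>x\<^sub>0\<close> and their steps tend to zero; the cuts then force
  \<open>c(x\<^sub>k)\<close> and the Minty gap to be nonpositive in the limit. Expanding
  \<open>\<parallel>x\<^sub>k - x\<^sub>0\<parallel> \<le> \<parallel>x* - x\<^sub>0\<parallel>\<close> gives
  \<open>\<parallel>x\<^sub>k - x*\<parallel>\<^sup>2 \<le> 2\<langle>x\<^sub>k - x*, x\<^sub>0 - x*\<rangle>\<close>, so it suffices that the right-hand side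
  is asymptotically nonpositive. Weak compactness is replaced by the fact that nested bounded closed
  convex sets in a Hilbert space have a common point: if the right-hand side exceeded some
  \<open>\<delta> > 0\<close> infinitely often, the sets of points satisfying this, with constraint
  violation and gap at most \<open>1/n\<close>, would share a point. By Minty's lemma it solves the
  variational inequality, yet it differs from the only solution \<open>x*\<close>.
\<close>

section \<open>Nearest points and nested closed convex sets\<close>

text \<open>Almost nearest points \<open>p n\<close> of \<open>A n\<close> form a Cauchy sequence by
  the parallelogram law, and completeness supplies the limit. A constant family yields metric
  projections; a decreasing bounded one yields a common point.\<close>

lemma nested_closed_convex_nearest_point:
  fixes A :: "nat \<Rightarrow> 'a::{real_inner, complete_space} set"
  assumes cl: "\<And>n. closed (A n)" and cv: "\<And>n. convex (A n)" and ne: "\<And>n. A n \<noteq> {}"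
    and dec: "decseq A" and lim: "(\<lambda>n. infdist a (A n)) \<longlonglongrightarrow> D"
  shows "\<exists>p. (\<forall>n. p \<in> A n) \<and> dist a p \<le> D"
proof -
  define d where "d n = infdist a (A n)" for n
  \<comment> \<open>The vanishing slack is there because the infimum distance is not yet known to be
    attained.\<close>
  define e where "e n = d n + 1 / real (Suc n)" for n
  have "\<exists>p\<in>A n. dist a p < e n" for n
  proof -
    have "d n < e n" unfolding e_def by simp
    then show ?thesis
      using ne[of n] infdist_notempty[of "A n" a] cInf_lessD[of "dist a ` A n" "e n"]
      unfolding d_def by auto
  qed
  then obtain p where pA: "\<And>n. p n \<in> A n" and pe: "\<And>n. dist a (p n) < e n"
    by metis
  have dlim: "d \<longlonglongrightarrow> D" using lim unfolding d_def .
  have "(\<lambda>n. d n + 1 / real (Suc n)) \<longlonglongrightarrow> D + 0"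
    by (intro tendsto_add dlim LIMSEQ_Suc lim_1_over_n)
  then have elim: "e \<longlonglongrightarrow> D" unfolding e_def by simp
  have sub: "m \<ge> n \<Longrightarrow> p m \<in> A n" for m n
    using decseqD[OF dec, of n m] pA by blast
  \<comment> \<open>Both points lie in \<open>A n\<close>, hence so does their midpoint, whose
    distance to \<open>a\<close> is therefore at least \<open>d n\<close>.\<close>
  have key: "(dist (p m) (p n))\<^sup>2 \<le> 2 * (e n)\<^sup>2 + 2 * (e m)\<^sup>2 - 4 * (d n)\<^sup>2" if "m \<ge> n" for m n
  proof -
    let ?q = "(1/2) *\<^sub>R p m + (1/2) *\<^sub>R p n"
    have "?q \<in> A n"
      using convexD[OF cv[of n] sub[OF that] pA, of "1/2" "1/2"] by simp
    then have "d n \<le> norm (a - ?q)" unfolding d_def dist_norm[symmetric] by (rule infdist_le)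
    then have 1: "(d n)\<^sup>2 \<le> (norm (a - ?q))\<^sup>2"
      unfolding d_def by (intro power_mono infdist_nonneg)
    have 2: "(dist a (p m))\<^sup>2 \<le> (e m)\<^sup>2" "(dist a (p n))\<^sup>2 \<le> (e n)\<^sup>2"
      using pe less_imp_le by (blast intro: power_mono zero_le_dist)+
    have "(dist (p m) (p n))\<^sup>2 = 2 * (dist a (p n))\<^sup>2 + 2 * (dist a (p m))\<^sup>2 - 4 * (norm (a - ?q))\<^sup>2"
      unfolding dist_norm power2_norm_eq_inner
      by (simp add: inner_diff inner_add inner_commute algebra_simps)
    with 1 2 show ?thesis by linarith
  qed
  have "Cauchy p"
  proof (rule metric_CauchyI)
    fix r :: real assume r: "r > 0"
    \<comment> \<open>With all squares within \<delta> of \<open>D\<^sup>2\<close>,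
      \<open>key\<close> leaves 8 \<delta>, just below \<open>r\<^sup>2\<close>.\<close>
    define \<delta> where "\<delta> = r\<^sup>2 / 9"
    have \<delta>: "\<delta> > 0" unfolding \<delta>_def using r by simp
    have e2: "(\<lambda>n. (e n)\<^sup>2) \<longlonglongrightarrow> D\<^sup>2" and d2: "(\<lambda>n. (d n)\<^sup>2) \<longlonglongrightarrow> D\<^sup>2"
      by (intro tendsto_power elim dlim)+
    have "\<forall>\<^sub>F n in sequentially. (e n)\<^sup>2 < D\<^sup>2 + \<delta>" "\<forall>\<^sub>F n in sequentially. (d n)\<^sup>2 > D\<^sup>2 - \<delta>"
      using order_tendstoD(2)[OF e2, of "D\<^sup>2 + \<delta>"] order_tendstoD(1)[OF d2, of "D\<^sup>2 - \<delta>"] \<delta> by auto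
    then have "\<forall>\<^sub>F n in sequentially. (e n)\<^sup>2 < D\<^sup>2 + \<delta> \<and> (d n)\<^sup>2 > D\<^sup>2 - \<delta>"
      by (rule eventually_conj)
    then obtain N where N: "\<And>n. n \<ge> N \<Longrightarrow> (e n)\<^sup>2 < D\<^sup>2 + \<delta> \<and> (d n)\<^sup>2 > D\<^sup>2 - \<delta>"
      unfolding eventually_sequentially by blast
    have *: "dist (p m) (p n) < r" if "m \<ge> n" "n \<ge> N" for m n
    proof -
      have "(dist (p m) (p n))\<^sup>2 < 8 * \<delta>"
        using key[OF that(1)] N[of n] N[of m] that by linarith
      also have "\<dots> < r\<^sup>2" using r unfolding \<delta>_def by simp
      finally show ?thesis using r power2_less_imp_less by fastforce
    qed
    show "\<exists>M. \<forall>m\<ge>M. \<forall>n\<ge>M. dist (p m) (p n) < r"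
      using * by (metis dist_commute nle_le)
  qed
  then obtain l where l: "p \<longlonglongrightarrow> l"
    using Cauchy_convergent_iff convergent_def by blast
  have "l \<in> A n" for n
    by (rule Lim_in_closed_set[OF cl _ _ l]) (use sub eventually_sequentially in auto)
  moreover have "dist a l \<le> D"
  proof (rule LIMSEQ_le)
    show "(\<lambda>n. dist a (p n)) \<longlonglongrightarrow> dist a l" by (intro tendsto_intros l)
    show "e \<longlonglongrightarrow> D" by (fact elim)
  qed (use pe less_imp_le in blast)
  ultimately show ?thesis by blast
qed

text \<open>Distances from 0 to shrinking sets increase, and boundedness of \<open>A 0\<close> caps
  them, so they converge as the nearest-point lemma demands.\<close>

lemma nested_bounded_closed_convex_nonempty:
  fixes A :: "nat \<Rightarrow> 'a::{real_inner, complete_space} set"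
  assumes cl: "\<And>n. closed (A n)" and cv: "\<And>n. convex (A n)" and ne: "\<And>n. A n \<noteq> {}"
    and dec: "decseq A" and bd: "bounded (A 0)"
  shows "(\<Inter>n. A n) \<noteq> {}"
proof -
  obtain B where B: "\<And>z. z \<in> A 0 \<Longrightarrow> dist 0 z \<le> B"
    using bd unfolding bounded_any_center[where a = 0] by blast
  have "incseq (\<lambda>n. infdist 0 (A n))"
    using ne by (intro incseq_SucI infdist_mono decseq_SucD[OF dec])
  moreover have "infdist 0 (A n) \<le> B" for n
  proof -
    obtain z where "z \<in> A n" using ne by blast
    moreover have "A n \<subseteq> A 0" using dec by (simp add: decseq_def)
    ultimately show ?thesis using B infdist_le2 by blast
  qed
  ultimately obtain D where "(\<lambda>n. infdist 0 (A n)) \<longlonglongrightarrow> D"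
    using incseq_convergent by blast
  from nested_closed_convex_nearest_point[OF cl cv ne dec this] show ?thesis by blast
qed

text \<open>The choice in \<open>metric_proj\<close> becomes meaningful once a nearest point exists;
  the constant family \<open>S\<close> provides one.\<close>

lemma metric_proj_closed_convex:
  fixes S :: "'a::{real_inner, complete_space} set"
  assumes "closed S" "convex S" "S \<noteq> {}"
  shows metric_proj_in: "metric_proj S a \<in> S"
    and metric_proj_dot: "z \<in> S \<Longrightarrow> (a - metric_proj S a) \<bullet> (z - metric_proj S a) \<le> 0"
proof -
  obtain p where "p \<in> S" "dist a p \<le> infdist a S"
    using nested_closed_convex_nearest_point[of "\<lambda>_. S" a "infdist a S"] assms
    by (auto simp: decseq_def)
  then have "\<exists>p. p \<in> S \<and> (\<forall>z\<in>S. dist a p \<le> dist a z)"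
    using infdist_le order_trans by blast
  then have *: "metric_proj S a \<in> S \<and> (\<forall>z\<in>S. dist a (metric_proj S a) \<le> dist a z)"
    unfolding metric_proj_def by (rule someI_ex)
  then show "metric_proj S a \<in> S" by blast
  show "(a - metric_proj S a) \<bullet> (z - metric_proj S a) \<le> 0" if "z \<in> S"
    using any_closest_point_dot assms(1,2) * that by blast
qed

section \<open>Halfspace cuts and the projection iteration\<close>

lemma convex_closed_halfspace:
  fixes a b :: "'a::real_inner"
  shows "convex {z. r + a \<bullet> (z - b) \<le> 0}" "closed {z. r + a \<bullet> (z - b) \<le> 0}"
proof -
  have "{z. r + a \<bullet> (z - b) \<le> 0} = {z. a \<bullet> z \<le> a \<bullet> b - r}"
    by (auto simp: inner_diff_right)
  then show "convex {z. r + a \<bullet> (z - b) \<le> 0}" by (simp add: convex_halfspace_le)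
  show "closed {z. r + a \<bullet> (z - b) \<le> 0}"
    by (intro closed_Collect_le continuous_intros)
qed

lemma convex_closed_cuts:
  shows "convex (cut_C c xk gk)" "closed (cut_C c xk gk)"
    and "convex (cut_H yk vk)" "closed (cut_H yk vk)"
    and "convex (cut_W x0 xk)" "closed (cut_W x0 xk)"
proof -
  show "convex (cut_C c xk gk)" "closed (cut_C c xk gk)"
    by (auto simp: cut_C_def simp del: inner_diff_right intro!: convex_closed_halfspace)
  show "convex (cut_H yk vk)" "closed (cut_H yk vk)"
    using convex_closed_halfspace[of 0 vk yk] by (simp_all only: cut_H_def add_0)
  have "cut_W x0 xk = {z. 0 + (x0 - xk) \<bullet> (z - xk) \<le> 0}"
    by (auto simp: cut_W_def inner_commute)
  then show "convex (cut_W x0 xk)" "closed (cut_W x0 xk)"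
    by (simp_all only: convex_closed_halfspace)
qed

text \<open>This isolates what uses only a point \<open>p\<close> common to all \<open>D k\<close>:
  \<open>p\<close> is never cut off, so the distances from \<open>x 0\<close> increase and stay
  bounded, which forces the steps to vanish.\<close>

lemma haugazeau_iteration:
  fixes x :: "nat \<Rightarrow> 'a::{real_inner, complete_space}"
  assumes D: "\<And>k. closed (D k)" "\<And>k. convex (D k)" and p: "\<And>k. p \<in> D k"
    and step: "\<And>k. x (Suc k) = metric_proj (D k \<inter> cut_W (x 0) (x k)) (x 0)"
  shows haugazeau_mem: "x (Suc k) \<in> D k"
    and haugazeau_bound: "norm (x k - x 0) \<le> norm (p - x 0)"
    and haugazeau_step: "(\<lambda>k. norm (x (Suc k) - x k)) \<longlonglongrightarrow> 0"
proof -
  define S where "S k = D k \<inter> cut_W (x 0) (x k)" for k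
  have S: "closed (S k)" "convex (S k)" for k
    unfolding S_def by (auto intro!: closed_Int convex_Int D convex_closed_cuts)
  have step': "x (Suc k) = metric_proj (S k) (x 0)" for k
    unfolding S_def by (rule step)
  \<comment> \<open>The obtuse-angle inequality of the projection onto \<open>S k\<close>, tested at
    \<open>p\<close>, is exactly membership of \<open>p\<close> in the next
    \<open>cut_W\<close>.\<close>
  have pW: "p \<in> cut_W (x 0) (x k)" for k
  proof (induction k)
    case 0
    show ?case by (simp add: cut_W_def)
  next
    case (Suc k)
    then have "p \<in> S k" using p by (simp add: S_def)
    from metric_proj_dot[OF S _ this, of "x 0"] this show ?case
      unfolding cut_W_def step' by (auto simp: inner_commute)
  qed
  then have "p \<in> S k" for k using p by (simp add: S_def)
  then have xS: "x (Suc k) \<in> S k" for k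
    unfolding step' by (intro metric_proj_in S) blast
  then show "x (Suc k) \<in> D k" by (auto simp: S_def)
  \<comment> \<open>Pythagorean inequality: \<open>cut_W\<close> says that the cross term in the
    expansion around \<open>x k\<close> has the right sign. Taking \<open>z\<close> as
    \<open>p\<close> bounds the iterates; taking \<open>z\<close> as \<open>x (Suc k)\<close>
    controls the step.\<close>
  have W: "(norm (z - x k))\<^sup>2 \<le> (norm (z - x 0))\<^sup>2 - (norm (x k - x 0))\<^sup>2"
    if "z \<in> cut_W (x 0) (x k)" for z k
  proof -
    have "(norm (z - x 0))\<^sup>2 = (norm (z - x k))\<^sup>2 + (norm (x k - x 0))\<^sup>2
        - 2 * ((z - x k) \<bullet> (x 0 - x k))"
      unfolding power2_norm_eq_inner by (simp add: inner_diff inner_commute algebra_simps)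
    with that show ?thesis unfolding cut_W_def by simp
  qed
  have le: "(norm (x k - x 0))\<^sup>2 \<le> (norm (z - x 0))\<^sup>2" if "z \<in> cut_W (x 0) (x k)" for z k
    using W[OF that] zero_le_power2[of "norm (z - x k)"] by linarith
  show "norm (x k - x 0) \<le> norm (p - x 0)"
    using le[OF pW] by (simp add: power2_le_iff_abs_le)
  define t where "t k = (norm (x k - x 0))\<^sup>2" for k
  have "incseq t"
    using le xS by (intro incseq_SucI) (auto simp: S_def t_def)
  moreover have "t k \<le> (norm (p - x 0))\<^sup>2" for k
    using le[OF pW] by (simp add: t_def)
  ultimately obtain L where L: "t \<longlonglongrightarrow> L" using incseq_convergent by blast
  have "(\<lambda>k. t (Suc k) - t k) \<longlonglongrightarrow> L - L"
    by (intro tendsto_diff LIMSEQ_Suc L)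
  then have diff: "(\<lambda>k. t (Suc k) - t k) \<longlonglongrightarrow> 0" by simp
  have "(\<lambda>k. (norm (x (Suc k) - x k))\<^sup>2) \<longlonglongrightarrow> 0"
  proof (rule Lim_null_comparison[OF _ diff], rule always_eventually, rule allI)
    show "norm ((norm (x (Suc k) - x k))\<^sup>2) \<le> t (Suc k) - t k" for k
      using W xS by (simp add: S_def t_def)
  qed
  from tendsto_real_sqrt[OF this] show "(\<lambda>k. norm (x (Suc k) - x k)) \<longlonglongrightarrow> 0"
    by simp
qed

section \<open>Feasible trial points, Minty's lemma and the oracle bound\<close>

text \<open>Convexity keeps \<open>c\<close> below its chord on the segment from \<open>p\<close> to
  \<open>s\<close>; for infeasible \<open>p\<close> the weight is the place where this chord
  vanishes.\<close>

lemma slater_retract_feasible: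
  assumes "convex_on UNIV c" "c s < 0"
  shows "slater_retract c s p \<in> feasible_set c"
proof (cases "c p \<le> 0")
  case True
  then show ?thesis by (simp add: slater_retract_def slater_weight_def feasible_set_def)
next
  case False
  define l where "l = c p / (c p - c s)"
  have l: "0 \<le> l" "l \<le> 1" "l * (c p - c s) = c p"
    using False assms(2) by (auto simp: l_def field_simps)
  have "c ((1 - l) *\<^sub>R p + l *\<^sub>R s) \<le> (1 - l) * c p + l * c s"
    using assms(1) l(1,2) unfolding convex_on_def by auto
  also have "\<dots> = 0" using l(3) by (simp add: algebra_simps)
  finally show ?thesis
    using False by (simp add: slater_retract_def slater_weight_def feasible_set_def l_def)
qed

lemma monotone_opD:
  "monotone_op T \<Longrightarrow> u \<in> T x \<Longrightarrow> v \<in> T y \<Longrightarrow> (u - v) \<bullet> (x - y) \<ge> 0"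
  unfolding monotone_op_def Gph_def by fast

text \<open>The hypothesis \<open>gap\<close> makes the pair \<open>(x, 0)\<close> monotonically
  related to the graph of the sum operator. Maximality then forces 0 into its value at
  \<open>x\<close>, which is the variational inequality.\<close>

lemma minty_solution:
  fixes T :: "'a::real_inner \<Rightarrow> 'a set"
  assumes mm: "maximal_monotone_op (sum_op T (normal_cone C))" and x: "x \<in> C"
    and gap: "\<And>z w. z \<in> C \<Longrightarrow> w \<in> T z \<Longrightarrow> w \<bullet> (x - z) \<le> 0"
  shows "x \<in> solution_set T C"
proof -
  let ?A = "sum_op T (normal_cone C)"
  \<comment> \<open>The extension by the single pair \<open>(x, 0)\<close>, to be tested against
    maximality.\<close>
  define S where "S z = ?A z \<union> (if z = x then {0} else {})" for z
  have rel: "u \<bullet> (z - x) \<ge> 0" if u: "u \<in> ?A z" for z u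
  proof -
    obtain w n where w: "w \<in> T z" and n: "n \<in> normal_cone C z" and "u = w + n"
      using u unfolding sum_op_def by blast
    moreover have "z \<in> C" "n \<bullet> (x - z) \<le> 0"
      using n x unfolding normal_cone_def by (auto split: if_splits)
    ultimately show ?thesis
      using gap[of z w] by (simp add: inner_add_left inner_diff_right)
  qed
  have mon: "(u - u') \<bullet> (z - z') \<ge> 0" if "u \<in> ?A z" "u' \<in> ?A z'" for u u' z z'
    using mm that unfolding maximal_monotone_op_def by (blast intro: monotone_opD)
  have "(u - u') \<bullet> (z - z') \<ge> 0" if "u \<in> S z" "u' \<in> S z'" for u u' z z'
    using that rel[of u z] rel[of u' z'] mon[of u z u' z'] unfolding S_def
    by (auto split: if_splits simp: inner_diff_right)
  then have "monotone_op S" by (auto simp: monotone_op_def Gph_def)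
  then have "Gph S = Gph ?A"
    using mm unfolding maximal_monotone_op_def S_def Gph_def by blast
  moreover have "(x, 0) \<in> Gph S" by (simp add: S_def Gph_def)
  ultimately have "0 \<in> ?A x" by (simp add: Gph_def)
  then obtain w n where w: "w \<in> T x" and n: "n \<in> normal_cone C x" and "w + n = 0"
    unfolding sum_op_def by force
  then have "n = - w" by (simp add: eq_neg_iff_add_eq_0 add.commute)
  then have "\<forall>z\<in>C. w \<bullet> (z - x) \<ge> 0" using n x by (simp add: normal_cone_def)
  with x w show ?thesis by (auto simp: solution_set_def)
qed

lemma solution_set_strongly_monotone_unique:
  assumes \<mu>: "\<mu> > 0" and T: "strongly_monotone_op \<mu> T"
    and x: "x \<in> solution_set T C" and y: "y \<in> solution_set T C"
  shows "x = y"
proof -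
  obtain u v where u: "u \<in> T x" "u \<bullet> (y - x) \<ge> 0" and v: "v \<in> T y" "v \<bullet> (x - y) \<ge> 0"
    using x y unfolding solution_set_def by blast
  have "\<mu> * (norm (x - y))\<^sup>2 \<le> (u - v) \<bullet> (x - y)"
    using T u(1) v(1) unfolding strongly_monotone_op_def Gph_def by fast
  also have "\<dots> \<le> 0" using u(2) v(2) by (simp add: inner_diff)
  finally show ?thesis using \<mu> by (simp add: mult_le_0_iff)
qed

text \<open>Monotonicity moves the inequality from an element of \<open>T x\<close> to any element
  of \<open>T z\<close>. For \<open>z\<close> equal to \<open>y k\<close>, this keeps solutions
  inside \<open>cut_H\<close>.\<close>

lemma solution_minty:
  assumes T: "monotone_op T" and x: "x \<in> solution_set T C" and z: "z \<in> C" and w: "w \<in> T z"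
  shows "w \<bullet> (x - z) \<le> 0"
proof -
  obtain u where u: "u \<in> T x" "u \<bullet> (z - x) \<ge> 0"
    using x z unfolding solution_set_def by blast
  have "(u - w) \<bullet> (x - z) \<ge> 0"
    using T u(1) w by (rule monotone_opD)
  with u(2) show ?thesis by (simp add: inner_diff)
qed

text \<open>The gap is a supremum in the extended reals, so it is first replaced by one real test
  value below it; only then is the inequality divided by \<sigma>.\<close>

lemma minty_gap_oracle_bound:
  assumes \<sigma>: "\<sigma> > 0" and z: "z \<in> C" and w: "w \<in> T z"
    and orc: "ereal b \<ge> ereal \<sigma> * minty_gap_plus T C x - ereal \<epsilon>"
  shows "w \<bullet> (x - z) \<le> (b + \<epsilon>) / \<sigma>"
proof -
  have "ereal (w \<bullet> (x - z)) \<le> minty_gap T C x"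
    unfolding minty_gap_def using z w by (intro Sup_upper) blast
  also have "\<dots> \<le> minty_gap_plus T C x" unfolding minty_gap_plus_def by simp
  finally have "ereal \<sigma> * ereal (w \<bullet> (x - z)) \<le> ereal \<sigma> * minty_gap_plus T C x"
    using \<sigma> by (intro ereal_mult_left_mono) auto
  then have "ereal (\<sigma> * (w \<bullet> (x - z))) - ereal \<epsilon> \<le> ereal \<sigma> * minty_gap_plus T C x - ereal \<epsilon>"
    by (intro ereal_minus_mono) auto
  with orc have "ereal (\<sigma> * (w \<bullet> (x - z)) - \<epsilon>) \<le> ereal b"
    by (metis order_trans ereal_minus(1))
  then have "\<sigma> * (w \<bullet> (x - z)) \<le> b + \<epsilon>" by simp
  then show ?thesis using \<sigma> by (simp add: pos_le_divide_eq mult.commute)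
qed

section \<open>A substitute for weak cluster points\<close>

text \<open>Approximate feasibility, approximate Minty inequalities and the lower bound \<delta> are
  all closed convex conditions, so they pass to a common point of nested sets although the iterates
  need not converge.\<close>

lemma frequently_inner_ge_imp_other_solution:
  fixes T :: "'a::{real_inner, complete_space} \<Rightarrow> 'a set"
  assumes cvx: "convex_on UNIV c" and cont: "continuous_on UNIV c"
    and mm: "maximal_monotone_op (sum_op T (normal_cone (feasible_set c)))"
    and bd: "bounded (range x)" and r: "r \<longlonglongrightarrow> 0"
    and cr: "\<And>k. c (x k) \<le> r k"
    and gr: "\<And>k z w. z \<in> feasible_set c \<Longrightarrow> w \<in> T z \<Longrightarrow> w \<bullet> (x k - z) \<le> r k"
    and freq: "\<exists>\<^sub>F k in sequentially. \<delta> \<le> (x k - p) \<bullet> a"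
  shows "\<exists>q\<in>solution_set T (feasible_set c). \<delta> \<le> (q - p) \<bullet> a"
proof -
  obtain R where R: "\<And>k. norm (x k) \<le> R"
    using bd unfolding bounded_iff by blast
  \<comment> \<open>The ball supplies boundedness, the two tolerances shrink with \<open>n\<close>,
    and the last halfspace stays fixed so that \<delta> survives in the limit.\<close>
  define A where "A n = cball 0 R \<inter> {z. c z \<le> 1 / real (Suc n)}
      \<inter> (\<Inter>z'\<in>feasible_set c. \<Inter>w\<in>T z'. {z. - (1 / real (Suc n)) + w \<bullet> (z - z') \<le> 0})
      \<inter> {z. \<delta> + (- a) \<bullet> (z - p) \<le> 0}" for n
  have clc: "closed {z. c z \<le> b}" for b
    by (intro closed_Collect_le cont continuous_intros)
  have cvc: "convex {z. c z \<le> b}" for b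
  proof (rule convexI)
    fix y z and u v :: real
    assume *: "y \<in> {z. c z \<le> b}" "z \<in> {z. c z \<le> b}" and uv: "0 \<le> u" "0 \<le> v" "u + v = 1"
    have "c (u *\<^sub>R y + v *\<^sub>R z) \<le> u * c y + v * c z"
      using cvx uv unfolding convex_on_def by auto
    also have "\<dots> \<le> b" using * uv by (auto intro: convex_bound_le)
    finally show "u *\<^sub>R y + v *\<^sub>R z \<in> {z. c z \<le> b}" by simp
  qed
  have "closed (A n)" "convex (A n)" for n
    unfolding A_def
    by (intro closed_Int closed_INT convex_Int convex_INT ballI clc cvc convex_closed_halfspace
        closed_cball convex_cball)+
  moreover have "A n \<noteq> {}" for n
  proof -
    \<comment> \<open>This holds eventually and the \<delta> bound frequently, so some iterate
      satisfies both and lies in \<open>A n\<close>.\<close>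
    have "\<forall>\<^sub>F k in sequentially. r k < 1 / real (Suc n)"
      by (intro order_tendstoD(2)[OF r]) simp
    from frequently_ex[OF frequently_eventually_conj[OF freq this]]
    obtain k where k: "\<delta> \<le> (x k - p) \<bullet> a" "r k < 1 / real (Suc n)"
      by blast
    have "x k \<in> A n"
      unfolding A_def
      using k R cr[of k] gr[of _ _ k] by (force simp: inner_commute)
    then show ?thesis by blast
  qed
  moreover have "decseq A"
  proof (rule decseq_SucI)
    fix n
    have "1 / real (Suc (Suc n)) \<le> 1 / real (Suc n)" by (simp add: frac_le)
    then show "A (Suc n) \<subseteq> A n" unfolding A_def by force
  qed
  moreover have "bounded (A 0)"
    by (rule bounded_subset[OF bounded_cball[of 0 R]]) (auto simp: A_def)
  ultimately have "(\<Inter>n. A n) \<noteq> {}"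
    by (intro nested_bounded_closed_convex_nonempty)
  then obtain q where q: "\<And>n. q \<in> A n" by auto
  have zero: "b \<le> 0" if "\<And>n. b \<le> 1 / real (Suc n)" for b :: real
    using LIMSEQ_le_const[OF LIMSEQ_Suc[OF lim_1_over_n], of b] that by blast
  have "c q \<le> 0" using q by (intro zero) (simp add: A_def)
  then have qC: "q \<in> feasible_set c" by (simp add: feasible_set_def)
  have "w \<bullet> (q - z) \<le> 0" if "z \<in> feasible_set c" "w \<in> T z" for z w
  proof (rule zero)
    fix n
    have "- (1 / real (Suc n)) + w \<bullet> (q - z) \<le> 0"
      using q[of n] that unfolding A_def by blast
    then show "w \<bullet> (q - z) \<le> 1 / real (Suc n)" by linarith
  qed
  then have "q \<in> solution_set T (feasible_set c)"
    by (rule minty_solution[OF mm qC])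
  moreover have "\<delta> \<le> (q - p) \<bullet> a"
    using q[of 0] by (simp add: A_def inner_commute)
  ultimately show ?thesis by blast
qed

section \<open>Strong convergence of the algorithm\<close>

theorem corollary5p1:
  fixes T :: "'a::{real_inner, complete_space} \<Rightarrow> 'a set"
    and c :: "'a \<Rightarrow> real"
    and C :: "'a set"
    and s :: 'a
    and \<sigma> \<mu> :: real
    and \<epsilon> :: "nat \<Rightarrow> real"
    and x g yt y v :: "nat \<Rightarrow> 'a"
  assumes C_def: "C = feasible_set c"
    and A1_convex: "convex_on UNIV c"
    and A1_continuous: "continuous_on UNIV c"
    and A1_nonempty: "C \<noteq> {}"
    and A1_bounded: "\<And>B. bounded B \<Longrightarrow>
          \<exists>M>0. \<forall>z\<in>B. c z > 0 \<longrightarrow> (\<forall>h\<in>subdifferential c z. norm h \<le> M)"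
    and A1_subdiff: "\<And>z. c z > 0 \<Longrightarrow> subdifferential c z \<noteq> {}"
    and A2: "c s < 0"
    and A3_maximal: "maximal_monotone_op T"
    and A3_dom: "C \<subseteq> dom_op T"
    and A3_solvable: "solution_set T C \<noteq> {}"
    and A3_sum: "maximal_monotone_op (sum_op T (normal_cone C))"
    and A4_sigma: "0 < \<sigma>" "\<sigma> \<le> 1"
    and A4_eps: "\<And>k. \<epsilon> k \<ge> 0" "\<epsilon> \<longlonglongrightarrow> 0"
    and A4_oracle: "oracle_condition T C \<sigma> \<epsilon> x y v"
    and strong: "\<mu> > 0" "strongly_monotone_op \<mu> T"
    and run: "FSPA T c s x g yt y v"
  shows "\<exists>xs. solution_set T C = {xs} \<and> x \<longlonglongrightarrow> xs"
proof -
  obtain xs where xs: "xs \<in> solution_set T C" using A3_solvable by blast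
  have unique: "q = xs" if "q \<in> solution_set T C" for q
    using solution_set_strongly_monotone_unique[OF strong that xs] .
  have xsC: "xs \<in> C" using xs by (simp add: solution_set_def)
  have mono: "monotone_op T" using A3_maximal by (simp add: maximal_monotone_op_def)
  have g: "c (x k) > 0 \<Longrightarrow> g k \<in> subdifferential c (x k)"
    and y: "y k = slater_retract c s (yt k)" and v: "v k \<in> T (y k)" for k
    using run unfolding FSPA_def by blast+
  have yC: "y k \<in> C" for k
    unfolding y C_def using slater_retract_feasible[OF A1_convex A2] .
  \<comment> \<open>Grouping these two cuts puts the algorithm into the form of
    \<open>haugazeau_iteration\<close>.\<close>
  define D where "D k = cut_C c (x k) (g k) \<inter> cut_H (y k) (v k)" for k
  have step: "x (Suc k) = metric_proj (D k \<inter> cut_W (x 0) (x k)) (x 0)" for k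
    using run by (simp add: FSPA_def D_def)
  have D: "closed (D k)" "convex (D k)" for k
    unfolding D_def by (auto intro!: closed_Int convex_Int convex_closed_cuts)
  \<comment> \<open>The subgradient inequality at the feasible point \<open>xs\<close> handles
    \<open>cut_C\<close>; Minty's inequality at \<open>y k\<close>, feasible by the retraction,
    handles \<open>cut_H\<close>.\<close>
  have xsD: "xs \<in> D k" for k
  proof -
    have "c (x k) + g k \<bullet> (xs - x k) \<le> 0" if "c (x k) > 0"
      using g[OF that] xsC unfolding subdifferential_def C_def feasible_set_def
      by (auto intro: order_trans)
    then show ?thesis
      using solution_minty[OF mono xs yC v] by (simp add: D_def cut_C_def cut_H_def)
  qed
  note haug = haugazeau_iteration[of D xs x, OF D xsD step]
  define d where "d k = norm (x (Suc k) - x k)" for k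
  have d: "d \<longlonglongrightarrow> 0" using haug(3) unfolding d_def .
  have bd: "bounded (range x)"
    by (rule bounded_subset[OF bounded_cball[of "x 0" "norm (xs - x 0)"]])
      (use haug(2) in \<open>auto simp: dist_norm norm_minus_commute\<close>)
  have bdv: "bounded (range v)"
    and orc: "ereal (max (v k \<bullet> (x k - y k)) 0)
        \<ge> ereal \<sigma> * minty_gap_plus T C (x k) - ereal (\<epsilon> k)" for k
    using A4_oracle bd by (auto simp: oracle_condition_def)
  obtain V where V: "\<And>k. norm (v k) \<le> V" "V > 0"
    using bdv unfolding bounded_pos by blast
  obtain M where M: "M > 0" "\<And>k. c (x k) > 0 \<Longrightarrow> norm (g k) \<le> M"
    using A1_bounded[OF bd] g by blast
  \<comment> \<open>A single null sequence dominating both errors: the first summand bounds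
    \<open>c (x k)\<close>, the second the Minty inequalities.\<close>
  define r where "r k = M * d k + (V * d k + \<epsilon> k) / \<sigma>" for k
  have "r \<longlonglongrightarrow> M * 0 + (V * 0 + 0) / \<sigma>"
    unfolding r_def using A4_sigma by (intro tendsto_intros d A4_eps) auto
  then have r: "r \<longlonglongrightarrow> 0" by simp
  have d0: "d k \<ge> 0" for k by (simp add: d_def)
  have cs: "u \<bullet> (x k - x (Suc k)) \<le> B * d k" if "norm u \<le> B" for u B k
    using norm_cauchy_schwarz[of u "x k - x (Suc k)"] mult_right_mono[OF that d0[of k]]
    unfolding d_def by (simp add: norm_minus_commute)
  \<comment> \<open>The next iterate satisfies the linearized constraint at \<open>x k\<close>, so
    any violation is paid for by the step length.\<close>
  have "c (x k) \<le> M * d k" for k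
  proof (cases "c (x k) > 0")
    case True
    then have "c (x k) + g k \<bullet> (x (Suc k) - x k) \<le> 0"
      using haug(1)[of k] by (simp add: D_def cut_C_def)
    then show ?thesis
      using cs[OF M(2)[OF True], of k] by (simp add: inner_diff_right)
  next
    case False
    then show ?thesis using M(1) d0[of k] mult_nonneg_nonneg[of M "d k"] by linarith
  qed
  moreover have "(V * d k + \<epsilon> k) / \<sigma> \<ge> 0" "M * d k \<ge> 0" for k
    using V(2) M(1) d0 A4_eps(1) A4_sigma(1) by simp_all
  ultimately have cr: "c (x k) \<le> r k" and r1: "(V * d k + \<epsilon> k) / \<sigma> \<le> r k" for k
    unfolding r_def by (simp_all add: add_increasing2)
  have gr: "w \<bullet> (x k - z) \<le> r k" if "z \<in> C" "w \<in> T z" for k z w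
  proof -
    have "v k \<bullet> (x (Suc k) - y k) \<le> 0"
      using haug(1)[of k] by (simp add: D_def cut_H_def)
    then have "v k \<bullet> (x k - y k) \<le> V * d k"
      using cs[OF V(1)[of k], of k] by (simp add: inner_diff_right)
    then have "max (v k \<bullet> (x k - y k)) 0 \<le> V * d k" using V(2) d0 by simp
    then have "(max (v k \<bullet> (x k - y k)) 0 + \<epsilon> k) / \<sigma> \<le> (V * d k + \<epsilon> k) / \<sigma>"
      using A4_sigma(1) by (intro divide_right_mono) auto
    then show ?thesis
      using minty_gap_oracle_bound[OF A4_sigma(1) that orc[of k]] r1[of k] by linarith
  qed
  have key: "(dist (x k) xs)\<^sup>2 \<le> 2 * ((x k - xs) \<bullet> (x 0 - xs))" for k
  proof -
    have "(norm (x k - x 0))\<^sup>2 = (dist (x k) xs)\<^sup>2 - 2 * ((x k - xs) \<bullet> (x 0 - xs))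
        + (norm (xs - x 0))\<^sup>2"
      unfolding dist_norm power2_norm_eq_inner
      by (simp add: inner_diff inner_commute algebra_simps)
    moreover have "(norm (x k - x 0))\<^sup>2 \<le> (norm (xs - x 0))\<^sup>2"
      using haug(2) by (intro power_mono) auto
    ultimately show ?thesis by linarith
  qed
  have "x \<longlonglongrightarrow> xs"
  proof (rule tendstoI)
    fix e :: real assume e: "e > 0"
    \<comment> \<open>The threshold absorbs the factor 2 in \<open>key\<close>. Frequent violation
      would produce a solution \<open>q\<close> with a positive inner product, whereas uniqueness
      gives \<open>q = xs\<close> and the value 0.\<close>
    have "\<not> (\<exists>\<^sub>F k in sequentially. e\<^sup>2 / 2 \<le> (x k - xs) \<bullet> (x 0 - xs))"
    proof
      assume "\<exists>\<^sub>F k in sequentially. e\<^sup>2 / 2 \<le> (x k - xs) \<bullet> (x 0 - xs)"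
      from frequently_inner_ge_imp_other_solution[OF A1_convex A1_continuous
          A3_sum[unfolded C_def] bd r cr gr[unfolded C_def] this]
      obtain q where "q \<in> solution_set T C" "e\<^sup>2 / 2 \<le> (q - xs) \<bullet> (x 0 - xs)"
        unfolding C_def by blast
      with unique[of q] e show False by simp
    qed
    then have "\<forall>\<^sub>F k in sequentially. (x k - xs) \<bullet> (x 0 - xs) < e\<^sup>2 / 2"
      by (simp add: not_frequently not_le)
    then show "\<forall>\<^sub>F k in sequentially. dist (x k) xs < e"
    proof eventually_elim
      case (elim k)
      then have "(dist (x k) xs)\<^sup>2 < e\<^sup>2" using key[of k] by linarith
      then show ?case using e by (auto intro: power2_less_imp_less)
    qed
  qed
  moreover have "solution_set T C = {xs}" using xs unique by blast
  ultimately show ?thesis by blast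
qed

end
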